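(* Let $k$ be a field, let $a>b$ be relatively prime positive integers, and write $a=bq+l$ with integers $q$ and $1\le l\le b-1$. Let $E_\Phi=\{(r,s,h,k',m)\in\mathbb{N}^5 : ar+h=m=bs+k'\}$. Then the number of minimal positive elements of $E_\Phi$ is at most $a-l+1$. In conclusion, the canonical ideal of the intersection algebra $\mathcal{B}((x^a),(x^b))$ of the ideals $(x^a),(x^b)$ of $k[x]$ has at most $a-l+1$ generators (i.e. it can be generated by at most $a-l+1$ elements).
   Context: $\mathbb{N}$ denotes the nonnegative integers. The intersection algebra of ideals $I,J$ of a ring $R$ is $\mathcal{B}(I,J)=\sum_{r,s\in\mathbb{N}}(I^r\cap J^s)u^rv^s\subseteq R[u,v]$. $E_\Phi$ is the set of solutions in $\mathbb{N}^5$ of $\Phi\boldsymbol\beta=0$ for $\Phi=\begin{pmatrix}a&0&1&0&-1\\0&b&0&1&-1\end{pmatrix}$. An element $\boldsymbol\beta\in E_\Phi$ is positive if each coordinate is positive. A positive $\boldsymbol\beta\in E_\Phi$ is minimal if there is no positive $\boldsymbol\gamma\in E_\Phi$ with $\boldsymbol\gamma\ne\boldsymbol\beta$ and $\boldsymbol\beta-\boldsymbol\gamma\ge0$ coordinatewise. The semigroup algebra $k[E_\Phi]$ is isomorphic to $\mathcal{B}((x^a),(x^b))$ via $(r,s,h,k',m)\mapsto x^mu^rv^s$. The canonical ideal of $\mathcal{B}((x^a),(x^b))$ is the ideal spanned over $k$ by the monomials corresponding to positive elements of $E_\Phi$ (by a theorem of Stanley it is isomorphic to the canonical module). *)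

theory Defs
  imports
    "HOL-Computational_Algebra.Polynomial"
    "HOL-Algebra.Algebra"
    "HOL-Algebra.Algebraic_Closure_Type"
begin

text \<open>For a commutative ring \<open>R\<close> (a type) the ring \<open>R[u,v]\<close> is the type \<open>R poly poly\<close>, with \<open>u\<close>
  the inner and \<open>v\<close> the outer variable, so \<open>c u\<^sup>r v\<^sup>s\<close> is \<open>monom (monom c r) s\<close>. Powers of ideals
  are powers in the multiplicative structure of \<^const>\<open>ideals_set\<close>, in particular
  the zeroth power of an ideal is the whole ring.\<close>

definition intersection_algebra :: "'r::comm_ring_1 set \<Rightarrow> 'r set \<Rightarrow> 'r poly poly ring" where
  "intersection_algebra I J = ring_of_type_algebra \<lparr>carrier :=
     {(\<Sum>(r, s)\<in>F. monom (monom (c r s) r) s) | F c. finite F \<and>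
        (\<forall>(r, s)\<in>F. c r s \<in> (I [^]\<^bsub>ideals_set ring_of_type_algebra\<^esub> (r::nat))
                       \<inter> (J [^]\<^bsub>ideals_set ring_of_type_algebra\<^esub> (s::nat)))}\<rparr>"

definition intersection_algebra_powers :: "nat \<Rightarrow> nat \<Rightarrow> 'k::field poly poly poly ring" where
  "intersection_algebra_powers a b =
     intersection_algebra (PIdl\<^bsub>ring_of_type_algebra\<^esub> (monom 1 a))
                          (PIdl\<^bsub>ring_of_type_algebra\<^esub> (monom 1 b))"

type_synonym nat5 = "nat \<times> nat \<times> nat \<times> nat \<times> nat"

definition E_Phi :: "nat \<Rightarrow> nat \<Rightarrow> nat5 set" where
  "E_Phi a b = {(r, s, h, k, m). a * r + h = m \<and> m = b * s + k}"

definition positive5 :: "nat5 \<Rightarrow> bool" where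
  "positive5 = (\<lambda>(r, s, h, k, m). 0 < r \<and> 0 < s \<and> 0 < h \<and> 0 < k \<and> 0 < m)"

definition le5 :: "nat5 \<Rightarrow> nat5 \<Rightarrow> bool" where
  "le5 = (\<lambda>(r, s, h, k, m) (r', s', h', k', m').
            r \<le> r' \<and> s \<le> s' \<and> h \<le> h' \<and> k \<le> k' \<and> m \<le> m')"

definition minimal_positive :: "nat \<Rightarrow> nat \<Rightarrow> nat5 set" where
  "minimal_positive a b = {\<beta> \<in> E_Phi a b. positive5 \<beta> \<and>
     \<not> (\<exists>\<gamma>\<in>E_Phi a b. positive5 \<gamma> \<and> \<gamma> \<noteq> \<beta> \<and> le5 \<gamma> \<beta>)}"

text \<open>The monomial \<open>x\<^sup>m u\<^sup>r v\<^sup>s\<close> of \<open>k[x][u,v]\<close> corresponding to \<open>(r, s, h, k', m)\<close>.\<close>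

definition monomial_of :: "nat5 \<Rightarrow> 'k::field poly poly poly" where
  "monomial_of = (\<lambda>(r, s, h, k, m). monom (monom (monom 1 m) r) s)"

text \<open>The action of the scalars \<open>k\<close> on \<open>k[x][u,v]\<close>; \<open>[:[:c:]:]\<close> is the constant \<open>c\<close> in \<open>k[x][u]\<close>.\<close>

definition scalar :: "'k::field \<Rightarrow> 'k poly poly poly \<Rightarrow> 'k poly poly poly" where
  "scalar c f = smult [:[:c:]:] f"

lemma module_scalar: "Modules.module scalar"
  by unfold_locales (auto simp: scalar_def smult_add_right smult_add_left[symmetric] one_pCons[symmetric])

definition canonical_ideal :: "nat \<Rightarrow> nat \<Rightarrow> 'k::field poly poly poly set" where
  "canonical_ideal a b = Modules.module.span scalar (monomial_of ` {\<beta> \<in> E_Phi a b. positive5 \<beta>})"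

end

theory Submission
  imports Defs
begin

text \<open>Why the bound holds. A solution \<open>(r, s, h, k, m)\<close> is determined by the exponents
  \<open>(r, s, m)\<close>; \<open>h\<close> and \<open>k\<close> are the slacks in \<open>a r \<le> m\<close> and \<open>b s \<le> m\<close>. Lowering \<open>h\<close>, \<open>k\<close> and
  \<open>m\<close> together by 1 preserves the equations, so a minimal positive solution has \<open>h = 1\<close> or
  \<open>k = 1\<close>, and the integer \<open>h - k = b s - a r\<close> determines both slacks. Two solutions with the
  same slacks are comparable, so \<open>h - k\<close> is injective on minimal positive solutions
  (\<open>inj_on_slack_diff\<close>), and it remains to bound the number of its values. With \<open>a = b q + l\<close>, every
  positive solution with \<open>h - k \<ge> b - l\<close> and \<open>k = 1\<close> lies above the one with \<open>r = 1\<close>, \<open>s = q + 1\<close>,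
  \<open>k = 1\<close>, whose slack difference is exactly \<open>b - l\<close>; every positive solution with
  \<open>h - k \<le> - l\<close> and \<open>h = 1\<close> lies above one of the \<open>q\<close> solutions with \<open>r = 1\<close>, \<open>1 \<le> s \<le> q\<close>,
  \<open>h = 1\<close>. This leaves at most \<open>q\<close> values that are \<open>\<le> - l\<close> and the \<open>b\<close> values between
  \<open>1 - l\<close> and \<open>b - l\<close>, hence \<open>b + q\<close> values (\<open>card_minimal_positive_le\<close>). Finally
  \<open>b + q \<le> b q + 1 = a - l + 1\<close> because \<open>(b - 1) (q - 1) \<ge> 0\<close>.

  The statement about ideals is the usual dictionary between monomial ideals and exponent sets. The
  intersection algebra consists of the polynomials whose exponents \<open>(r, s, m)\<close> all lie in the
  cone \<open>a r \<le> m\<close>, \<open>b s \<le> m\<close> (\<open>carrier_intersection_algebra_powers\<close>), and the canonical ideal of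
  those whose exponents all lie in the interior of the cone (\<open>canonical_ideal_eq\<close>). If
  \<open>\<gamma> \<le> \<beta>\<close> coordinatewise then \<open>\<beta> - \<gamma>\<close> is again a solution, so the monomial of \<open>\<beta>\<close> is a
  multiple in the algebra of the monomial of \<open>\<gamma>\<close>; since every positive solution lies above a
  minimal one, the minimal monomials generate the ideal
  (\<open>Idl_minimal_positive_eq_canonical_ideal\<close>).\<close>

section \<open>Minimal positive solutions\<close>

lemma minimal_positive_le_imp_eq:
  assumes "\<beta> \<in> minimal_positive a b" "\<gamma> \<in> E_Phi a b" "positive5 \<gamma>" "le5 \<gamma> \<beta>"
  shows "\<gamma> = \<beta>"
  using assms unfolding minimal_positive_def mem_Collect_eq by metis

lemma minimal_positiveD:
  assumes "(r, s, h, k, m) \<in> minimal_positive a b"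
  shows "a * r + h = m" "b * s + k = m" "0 < r" "0 < s" "0 < h" "0 < k"
  using assms by (auto simp: minimal_positive_def E_Phi_def positive5_def)

lemma minimal_positive_h_or_k_eq_1:
  assumes \<beta>: "(r, s, h, k, m) \<in> minimal_positive a b"
  shows "h = 1 \<or> k = 1"
proof (rule ccontr)
  note eqs = minimal_positiveD[OF \<beta>]
  assume "\<not> (h = 1 \<or> k = 1)"
  with eqs have hk: "2 \<le> h" "2 \<le> k" by auto
  have "(r, s, h - 1, k - 1, m - 1) = (r, s, h, k, m)"
    by (rule minimal_positive_le_imp_eq[OF \<beta>])
       (use eqs hk in \<open>auto simp: E_Phi_def positive5_def le5_def\<close>)
  with hk show False by auto
qed

definition slack_diff :: "nat5 \<Rightarrow> int" where
  "slack_diff = (\<lambda>(r, s, h, k, m). int h - int k)"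

text \<open>As one slack is 1, the difference determines both slacks. With the slacks fixed, a larger
  \<open>r\<close> forces a larger \<open>m = a r + h\<close>, which forces a larger \<open>s\<close>; so the two solutions are
  comparable and minimality makes them equal.\<close>

lemma inj_on_slack_diff:
  assumes "0 < b"
  shows "inj_on slack_diff (minimal_positive a b)"
proof -
  have main: "\<beta> = \<beta>'"
    if \<beta>: "\<beta> \<in> minimal_positive a b" and \<beta>': "\<beta>' \<in> minimal_positive a b"
      and eq: "slack_diff \<beta> = slack_diff \<beta>'" and le: "fst \<beta> \<le> fst \<beta>'" for \<beta> \<beta>'
  proof -
    obtain r s h k m where B: "\<beta> = (r, s, h, k, m)" by (cases \<beta>)
    obtain r' s' h' k' m' where B': "\<beta>' = (r', s', h', k', m')" by (cases \<beta>')
    note e = minimal_positiveD[OF \<beta>[unfolded B]]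
    note e' = minimal_positiveD[OF \<beta>'[unfolded B']]
    have "r \<le> r'" using le B B' by simp
    have hk: "h = h'" "k = k'"
      using minimal_positive_h_or_k_eq_1[OF \<beta>[unfolded B]]
        minimal_positive_h_or_k_eq_1[OF \<beta>'[unfolded B']] eq e(5,6) e'(5,6)
      by (auto simp: B B' slack_diff_def)
    have "a * r \<le> a * r'" using \<open>r \<le> r'\<close> by simp
    then have "m \<le> m'" using e(1) e'(1) hk by linarith
    then have "b * s \<le> b * s'" using e(2) e'(2) hk by linarith
    with \<open>0 < b\<close> have "s \<le> s'" by simp
    show ?thesis
      by (rule minimal_positive_le_imp_eq[OF \<beta>'])
         (use \<open>r \<le> r'\<close> \<open>s \<le> s'\<close> \<open>m \<le> m'\<close> hk \<beta> in
           \<open>auto simp: minimal_positive_def le5_def B B'\<close>)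
  qed
  show ?thesis
    by (intro inj_onI) (metis main nle_le)
qed

context
  fixes a b Q L :: nat
  assumes a_eq: "a = b * Q + L" and L: "1 \<le> L" "L < b" and Q: "1 \<le> Q"
begin

text \<open>A positive solution with \<open>k = 1\<close> and \<open>h - k > b - L\<close> lies strictly above the one with
  \<open>r = 1\<close>, \<open>s = Q + 1\<close>, \<open>k = 1\<close>: from \<open>b s > a r + b - L \<ge> a + b - L = b (Q + 1)\<close> one gets
  \<open>s > Q + 1\<close>.\<close>

lemma minimal_positive_slack_diff_le:
  assumes \<beta>: "(r, s, h, k, m) \<in> minimal_positive a b"
  shows "h \<le> k + (b - L)"
proof (rule ccontr)
  assume neg: "\<not> h \<le> k + (b - L)"
  note e = minimal_positiveD[OF \<beta>]
  have k: "k = 1" using minimal_positive_h_or_k_eq_1[OF \<beta>] neg e by auto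
  have "a * 1 \<le> a * r" using e by (intro mult_le_mono2) simp
  then have "b * (Q + 1) < b * s" using e(1,2) neg L a_eq k by (simp add: algebra_simps)
  then have s: "Q + 1 < s" by (simp only: mult_less_cancel1)
  have "(1, Q + 1, b - L + 1, 1, b * (Q + 1) + 1) = (r, s, h, k, m)"
    by (rule minimal_positive_le_imp_eq[OF \<beta>])
       (use e s k neg L a_eq \<open>b * (Q + 1) < b * s\<close> in \<open>auto simp: E_Phi_def positive5_def le5_def\<close>)
  with s show False by auto
qed

text \<open>A positive solution with \<open>h - k \<le> - L\<close> and \<open>h = 1\<close> lies above the one with \<open>r = 1\<close>,
  \<open>h = 1\<close> and second coordinate \<open>min s Q\<close>, hence equals it if it is minimal. So the slack
  difference takes one of the \<open>Q\<close> values \<open>b j - a\<close> with \<open>1 \<le> j \<le> Q\<close>.\<close>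

lemma minimal_positive_very_negative_slack_diff:
  assumes \<beta>: "(r, s, h, k, m) \<in> minimal_positive a b" and ge: "h + L \<le> k"
  shows "h = 1" "s \<le> Q" "k + b * s = a + 1"
proof -
  note e = minimal_positiveD[OF \<beta>]
  show h: "h = 1" using minimal_positive_h_or_k_eq_1[OF \<beta>] ge e L by auto
  define j where "j = min s Q"
  have j: "1 \<le> j" "j \<le> s" "j \<le> Q" using e Q by (auto simp: j_def)
  have "a \<le> a * r" using e by simp
  have "b * j \<le> b * Q" using j by simp
  then have bj: "b * j \<le> a" using a_eq by linarith
  \<comment> \<open>The slack \<open>a - b j + 1\<close> of the smaller solution is at most \<open>k\<close>: for \<open>j = s\<close> because
    \<open>r \<ge> 1\<close>, for \<open>j = Q\<close> because it equals \<open>L + 1\<close>.\<close>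
  have le: "a + 1 \<le> k + b * j"
  proof (cases "s \<le> Q")
    case True
    then have "j = s" by (simp add: j_def)
    moreover have "a + 1 \<le> k + b * s" using e h \<open>a \<le> a * r\<close> by linarith
    ultimately show ?thesis by simp
  next
    case False
    then show ?thesis using a_eq ge h by (simp add: j_def)
  qed
  have "(1, j, 1, a - b * j + 1, a + 1) = (r, s, h, k, m)"
    by (rule minimal_positive_le_imp_eq[OF \<beta>])
       (use e h j bj le \<open>a \<le> a * r\<close> in \<open>auto simp: E_Phi_def positive5_def le5_def\<close>)
  then show "s \<le> Q" "k + b * s = a + 1" using j bj by auto
qed

lemma card_minimal_positive_le:
  "finite (minimal_positive a b)" "card (minimal_positive a b) \<le> b + Q"
proof -
  let ?D = "{- int L + 1..int b - int L} \<union> (\<lambda>j. int b * int j - int a) ` {1..Q}"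
  have sub: "slack_diff ` minimal_positive a b \<subseteq> ?D"
  proof (rule image_subsetI)
    fix \<beta> assume \<beta>: "\<beta> \<in> minimal_positive a b"
    obtain r s h k m where B: "\<beta> = (r, s, h, k, m)" by (cases \<beta>)
    note e = minimal_positiveD[OF \<beta>[unfolded B]]
    show "slack_diff \<beta> \<in> ?D"
    proof (cases "h + L \<le> k")
      case True
      note lo = minimal_positive_very_negative_slack_diff[OF \<beta>[unfolded B] True]
      have "int k + int b * int s = int a + 1" using lo(3) by (metis of_nat_1 of_nat_add of_nat_mult)
      then have "slack_diff \<beta> = int b * int s - int a" using lo by (simp add: slack_diff_def B)
      then show ?thesis using lo e by auto
    next
      case False
      then show ?thesis
        using minimal_positive_slack_diff_le[OF \<beta>[unfolded B]] L by (auto simp: slack_diff_def B)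
    qed
  qed
  have fin: "finite ?D" by simp
  have "0 < b" using L by simp
  note inj = inj_on_slack_diff[OF this]
  show "finite (minimal_positive a b)"
    using finite_imageD[OF finite_subset[OF sub fin] inj] .
  have "card (minimal_positive a b) = card (slack_diff ` minimal_positive a b)"
    by (rule card_image[OF inj, symmetric])
  also have "\<dots> \<le> card ?D" by (rule card_mono[OF fin sub])
  also have "\<dots> \<le> card {- int L + 1..int b - int L} + card ((\<lambda>j. int b * int j - int a) ` {1..Q})"
    by (rule card_Un_le)
  also have "\<dots> \<le> b + Q"
    using card_image_le[of "{1..Q}" "\<lambda>j. int b * int j - int a"] by simp
  finally show "card (minimal_positive a b) \<le> b + Q" .
qed

end

lemma ex_minimal_positive_le5:
  assumes "\<beta> \<in> E_Phi a b" "positive5 \<beta>"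
  shows "\<exists>\<gamma>\<in>minimal_positive a b. le5 \<gamma> \<beta>"
  using assms
proof (induction "case \<beta> of (r, s, h, k, m) \<Rightarrow> r + s + h + k + m" arbitrary: \<beta> rule: less_induct)
  case less
  show ?case
  proof (cases "\<beta> \<in> minimal_positive a b")
    case True
    then show ?thesis by (auto simp: le5_def intro!: bexI[of _ \<beta>])
  next
    case False
    then obtain \<gamma> where \<gamma>: "\<gamma> \<in> E_Phi a b" "positive5 \<gamma>" "\<gamma> \<noteq> \<beta>" "le5 \<gamma> \<beta>"
      using less.prems by (auto simp: minimal_positive_def)
    have "(case \<gamma> of (r, s, h, k, m) \<Rightarrow> r + s + h + k + m) < (case \<beta> of (r, s, h, k, m) \<Rightarrow> r + s + h + k + m)"
      using \<gamma>(3,4) by (cases \<gamma>; cases \<beta>) (auto simp: le5_def)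
    from less.hyps[OF this \<gamma>(1,2)] obtain \<delta> where "\<delta> \<in> minimal_positive a b" "le5 \<delta> \<gamma>" by blast
    moreover from this \<gamma>(4) have "le5 \<delta> \<beta>"
      by (cases \<gamma>; cases \<beta>; cases \<delta>) (auto simp: le5_def)
    ultimately show ?thesis by blast
  qed
qed

section \<open>Polynomials in three variables with prescribed exponents\<close>

text \<open>The order \<open>(r, s, m)\<close> follows the monomial \<open>x\<^sup>m u\<^sup>r v\<^sup>s\<close>; \<open>v\<close> is the outermost variable, so
  its exponent \<open>s\<close> is extracted first.\<close>

definition exponents :: "'r::comm_ring_1 poly poly poly \<Rightarrow> (nat \<times> nat \<times> nat) set" where
  "exponents f = {(r, s, m). coeff (coeff (coeff f s) r) m \<noteq> 0}"

lemma exponents_subset_iff: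
  "exponents f \<subseteq> S \<longleftrightarrow> (\<forall>r s m. (r, s, m) \<notin> S \<longrightarrow> coeff (coeff (coeff f s) r) m = 0)"
  by (auto simp: exponents_def)

lemma exponents_0 [simp]: "exponents 0 = {}"
  by (simp add: exponents_def)

lemma exponents_add: "exponents (f + g) \<subseteq> exponents f \<union> exponents g"
  by (auto simp: exponents_def)

lemma exponents_uminus [simp]: "exponents (- f) = exponents f"
  by (auto simp: exponents_def)

lemma exponents_monom:
  "exponents (monom (monom p r) s) = {(r', s', m). r' = r \<and> s' = s \<and> coeff p m \<noteq> 0}"
  by (auto simp: exponents_def split: if_splits)

lemma exponents_mult:
  assumes "exponents f \<subseteq> S" "exponents g \<subseteq> T"
    and "\<And>r s m r' s' m'. (r, s, m) \<in> S \<Longrightarrow> (r', s', m') \<in> T \<Longrightarrow> (r + r', s + s', m + m') \<in> U"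
  shows "exponents (f * g) \<subseteq> U"
proof
  fix e assume "e \<in> exponents (f * g)"
  then obtain r s m where e: "e = (r, s, m)" and "coeff (coeff (coeff (f * g) s) r) m \<noteq> 0"
    by (auto simp: exponents_def)
  then have "(\<Sum>i\<le>s. \<Sum>j\<le>r. \<Sum>n\<le>m. coeff (coeff (coeff f i) j) n
      * coeff (coeff (coeff g (s - i)) (r - j)) (m - n)) \<noteq> 0"
    by (simp add: coeff_mult coeff_sum)
  then obtain i where i: "i \<le> s" "(\<Sum>j\<le>r. \<Sum>n\<le>m. coeff (coeff (coeff f i) j) n
      * coeff (coeff (coeff g (s - i)) (r - j)) (m - n)) \<noteq> 0"
    by (metis (no_types, lifting) atMost_iff sum.not_neutral_contains_not_neutral)
  then obtain j where j: "j \<le> r" "(\<Sum>n\<le>m. coeff (coeff (coeff f i) j) n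
      * coeff (coeff (coeff g (s - i)) (r - j)) (m - n)) \<noteq> 0"
    by (metis (no_types, lifting) atMost_iff sum.not_neutral_contains_not_neutral)
  then obtain n where n: "n \<le> m" "coeff (coeff (coeff f i) j) n
      * coeff (coeff (coeff g (s - i)) (r - j)) (m - n) \<noteq> 0"
    by (metis (no_types, lifting) atMost_iff sum.not_neutral_contains_not_neutral)
  then have "(j, i, n) \<in> S" "(r - j, s - i, m - n) \<in> T"
    using assms(1,2) by (auto simp: exponents_def)
  from assms(3)[OF this] show "e \<in> U" using i j n e by simp
qed

lemma finite_nonzero_coeffs2:
  fixes f :: "'r::comm_ring_1 poly poly"
  shows "finite {(r, s). coeff (coeff f s) r \<noteq> 0}"
proof (rule finite_subset)
  show "{(r, s). coeff (coeff f s) r \<noteq> 0} \<subseteq> (\<Union>s\<le>degree f. {..degree (coeff f s)} \<times> {s})"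
    by (force intro!: le_degree)
qed auto

lemma poly2_as_sum_of_monoms:
  fixes f :: "'r::comm_ring_1 poly poly"
  shows "(\<Sum>(r, s)\<in>{(r, s). coeff (coeff f s) r \<noteq> 0}. monom (monom (coeff (coeff f s) r) r) s) = f"
proof (intro poly_eqI)
  fix n i
  let ?F = "{(r, s). coeff (coeff f s) r \<noteq> 0}"
  have "coeff (coeff (\<Sum>(r, s)\<in>?F. monom (monom (coeff (coeff f s) r) r) s) n) i
      = (\<Sum>x\<in>?F. if (i, n) = x then coeff (coeff f n) i else 0)"
    by (auto simp: coeff_sum case_prod_unfold intro!: sum.cong)
  also have "\<dots> = coeff (coeff f n) i"
    using finite_nonzero_coeffs2[of f] by (subst sum.delta') auto
  finally show "coeff (coeff (\<Sum>(r, s)\<in>?F. monom (monom (coeff (coeff f s) r) r) s) n) i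
      = coeff (coeff f n) i" .
qed

interpretation scal: Modules.module scalar
  by (rule module_scalar)

lemma scalar_eq_mult: "scalar c f = [:[:[:c:]:]:] * f"
  by (simp add: scalar_def)

lemma scalar_monom: "scalar c (monom (monom (monom d m) r) s) = monom (monom (monom (c * d) m) r) s"
  by (simp add: scalar_def smult_monom)

lemma span_monomials:
  "scal.span {monom (monom (monom (1::'k::field) m) r) s | r s m. (r, s, m) \<in> S}
     = {f. exponents f \<subseteq> S}" (is "scal.span ?M = ?E")
proof (rule antisym)
  show "scal.span ?M \<subseteq> ?E"
  proof (rule scal.span_minimal)
    show "?M \<subseteq> ?E" by (auto simp: exponents_monom split: if_splits)
    show "scal.subspace ?E"
      by (auto simp: scal.subspace_def exponents_subset_iff scalar_def)
  qed
  show "?E \<subseteq> scal.span ?M"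
  proof
    fix f :: "'k poly poly poly" assume "f \<in> ?E"
    then have f: "exponents f \<subseteq> S" by simp
    have "monom (monom (coeff (coeff f s) r) r) s \<in> scal.span ?M" for r s
    proof -
      let ?p = "coeff (coeff f s) r"
      have "monom (monom (monom (coeff ?p m) m) r) s \<in> scal.span ?M" for m
      proof (cases "coeff ?p m = 0")
        case False
        then have "(r, s, m) \<in> S" using f by (auto simp: exponents_def)
        then have "scalar (coeff ?p m) (monom (monom (monom 1 m) r) s) \<in> scal.span ?M"
          by (intro scal.span_scale scal.span_base) blast
        then show ?thesis by (simp add: scalar_monom)
      qed (simp add: scal.span_zero)
      then have "(\<Sum>m\<le>degree ?p. monom (monom (monom (coeff ?p m) m) r) s) \<in> scal.span ?M"
        by (intro scal.span_sum)
      also have "(\<Sum>m\<le>degree ?p. monom (monom (monom (coeff ?p m) m) r) s)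
          = monom (monom (\<Sum>m\<le>degree ?p. monom (coeff ?p m) m) r) s"
        by (simp only: monom_sum)
      finally show ?thesis by (simp only: poly_as_sum_of_monoms)
    qed
    then have "(\<Sum>(r, s)\<in>{(r, s). coeff (coeff f s) r \<noteq> 0}. monom (monom (coeff (coeff f s) r) r) s)
        \<in> scal.span ?M"
      by (intro scal.span_sum) auto
    then show "f \<in> scal.span ?M" by (simp only: poly2_as_sum_of_monoms)
  qed
qed

section \<open>The intersection algebra and its canonical ideal\<close>

text \<open>The ideals involved are principal, so their powers and intersections become divisibility
  conditions.\<close>

lemma ring_of_type_algebra_simps [simp]:
  "carrier (ring_of_type_algebra :: 'r::comm_ring_1 ring) = UNIV"
  "monoid.mult (ring_of_type_algebra :: 'r::comm_ring_1 ring) = (*)"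
  "monoid.one (ring_of_type_algebra :: 'r::comm_ring_1 ring) = 1"
  "ring.zero (ring_of_type_algebra :: 'r::comm_ring_1 ring) = 0"
  "ring.add (ring_of_type_algebra :: 'r::comm_ring_1 ring) = (+)"
  by (simp_all add: ring_of_type_algebra_def)

lemma PIdl_eq_multiples:
  "PIdl\<^bsub>ring_of_type_algebra\<^esub> (p :: 'r::comm_ring_1) = {x. p dvd x}"
  by (auto simp: cgenideal_def dvd_def mult.commute)

lemma ideal_prod_multiples:
  "ideal_prod ring_of_type_algebra {x. p dvd x} {x. q dvd x} = {x::'r::comm_ring_1. p * q dvd x}"
proof (intro equalityI subsetI)
  fix x assume "x \<in> ideal_prod ring_of_type_algebra {x. p dvd x} {x. q dvd x}"
  then show "x \<in> {x. p * q dvd x}"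
    by (induction rule: ideal_prod.induct) (auto intro: mult_dvd_mono dvd_add)
next
  fix x assume "x \<in> {x. p * q dvd x}"
  then obtain y where "x = p * (q * y)" by (auto simp: dvd_def mult.assoc)
  then show "x \<in> ideal_prod ring_of_type_algebra {x. p dvd x} {x. q dvd x}"
    using ideal_prod.prod[of p "{x. p dvd x}" "q * y" "{x. q dvd x}" ring_of_type_algebra] by simp
qed

lemma PIdl_pow_eq_multiples:
  "(PIdl\<^bsub>ring_of_type_algebra\<^esub> p) [^]\<^bsub>ideals_set ring_of_type_algebra\<^esub> (n::nat)
     = {x::'r::comm_ring_1. p ^ n dvd x}"
  by (induction n) (simp_all add: nat_pow_def ideals_set_def PIdl_eq_multiples ideal_prod_multiples mult.commute)

definition solution_cone :: "nat \<Rightarrow> nat \<Rightarrow> (nat \<times> nat \<times> nat) set" where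
  "solution_cone a b = {(r, s, m). a * r \<le> m \<and> b * s \<le> m}"

definition interior_cone :: "nat \<Rightarrow> nat \<Rightarrow> (nat \<times> nat \<times> nat) set" where
  "interior_cone a b = {(r, s, m). 0 < r \<and> 0 < s \<and> a * r < m \<and> b * s < m}"

text \<open>A coefficient of \<open>u\<^sup>r v\<^sup>s\<close> lies in \<open>(x\<^sup>a)\<^sup>r \<inter> (x\<^sup>b)\<^sup>s\<close> iff none of its terms has degree below
  \<open>a r\<close> or below \<open>b s\<close>; this is a condition on each exponent separately, which makes
  closure under the ring operations a statement about cones.\<close>

lemma carrier_intersection_algebra_powers:
  "carrier (intersection_algebra_powers a b) = {f :: 'k::field poly poly poly. exponents f \<subseteq> solution_cone a b}"
  (is "_ = ?E")
proof -
  let ?ok = "\<lambda>r s p. (monom 1 a :: 'k poly) ^ r dvd p \<and> monom 1 b ^ s dvd p"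
  have ok: "?ok r s p \<longleftrightarrow> (\<forall>m. (r, s, m) \<notin> solution_cone a b \<longrightarrow> coeff p m = 0)" for r s and p :: "'k poly"
    by (auto simp: monom_power monom_1_dvd_iff' solution_cone_def not_le)
  have "carrier (intersection_algebra_powers a b) =
     {(\<Sum>(r, s)\<in>F. monom (monom (c r s) r) s) | F c. finite F \<and> (\<forall>(r, s)\<in>F. ?ok r s (c r s))}"
    unfolding intersection_algebra_powers_def intersection_algebra_def PIdl_pow_eq_multiples by simp
  also have "\<dots> = ?E"
  proof (intro equalityI subsetI)
    fix f assume "f \<in> {(\<Sum>(r, s)\<in>F. monom (monom (c r s) r) s) | F c.
        finite F \<and> (\<forall>(r, s)\<in>F. ?ok r s (c r s))}"
    then obtain F c where f: "f = (\<Sum>(r, s)\<in>F. monom (monom (c r s) r) s)"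
      and F: "finite F" "\<forall>(r, s)\<in>F. ?ok r s (c r s)" by blast
    have "coeff (coeff (coeff f s) r) m = 0" if "(r, s, m) \<notin> solution_cone a b" for r s m
    proof -
      have "coeff (coeff (coeff (monom (monom (c r' s') r') s') s) r) m = 0"
        if "(r', s') \<in> F" for r' s'
      proof -
        have "?ok r' s' (c r' s')" using F(2) that by auto
        then show ?thesis
          using \<open>(r, s, m) \<notin> solution_cone a b\<close> unfolding ok by auto
      qed
      then show ?thesis
        unfolding f coeff_sum by (intro sum.neutral) auto
    qed
    then show "f \<in> ?E" by (simp add: exponents_subset_iff)
  next
    fix f assume "f \<in> ?E"
    then have "?ok r s (coeff (coeff f s) r)" for r s
      unfolding ok by (simp add: exponents_subset_iff)
    then show "f \<in> {(\<Sum>(r, s)\<in>F. monom (monom (c r s) r) s) | F c.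
        finite F \<and> (\<forall>(r, s)\<in>F. ?ok r s (c r s))}"
      using poly2_as_sum_of_monoms[of f, symmetric] finite_nonzero_coeffs2[of f]
      by (intro CollectI exI[of _ "{(r, s). coeff (coeff f s) r \<noteq> 0}"]
            exI[of _ "\<lambda>r s. coeff (coeff f s) r"]) simp
  qed
  finally show ?thesis .
qed

lemma intersection_algebra_powers_simps [simp]:
  "monoid.mult (intersection_algebra_powers a b :: 'k::field poly poly poly ring) = (*)"
  "monoid.one (intersection_algebra_powers a b :: 'k::field poly poly poly ring) = 1"
  "ring.zero (intersection_algebra_powers a b :: 'k::field poly poly poly ring) = 0"
  "ring.add (intersection_algebra_powers a b :: 'k::field poly poly poly ring) = (+)"
  by (simp_all add: intersection_algebra_powers_def intersection_algebra_def)

lemma const_in_carrier: "[:[:[:c:]:]:] \<in> carrier (intersection_algebra_powers a b)"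
  by (auto simp: carrier_intersection_algebra_powers exponents_def solution_cone_def coeff_pCons split: nat.splits)

lemma ring_intersection_algebra_powers:
  "ring (intersection_algebra_powers a b :: 'k::field poly poly poly ring)"
proof -
  interpret R: ring "ring_of_type_algebra :: 'k poly poly poly ring"
    by (rule ring_from_type_algebra)
  let ?C = "carrier (intersection_algebra_powers a b :: 'k poly poly poly ring)"
  have uminus: "\<ominus>\<^bsub>ring_of_type_algebra\<^esub> f = - f" for f :: "'k poly poly poly"
    by (rule R.minus_equality) auto
  have "subring ?C (ring_of_type_algebra :: 'k poly poly poly ring)"
  proof (rule R.subringI)
    show "\<one>\<^bsub>ring_of_type_algebra\<^esub> \<in> ?C" using const_in_carrier[of 1 a b] by (simp add: one_pCons)
    fix f g assume fg: "f \<in> ?C" "g \<in> ?C"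
    show "\<ominus>\<^bsub>ring_of_type_algebra\<^esub> f \<in> ?C"
      using fg by (simp add: uminus carrier_intersection_algebra_powers)
    show "f \<oplus>\<^bsub>ring_of_type_algebra\<^esub> g \<in> ?C"
      using fg exponents_add[of f g] by (auto simp: carrier_intersection_algebra_powers)
    show "f \<otimes>\<^bsub>ring_of_type_algebra\<^esub> g \<in> ?C"
      using fg exponents_mult[of f "solution_cone a b" g "solution_cone a b" "solution_cone a b"]
      by (auto simp: carrier_intersection_algebra_powers solution_cone_def algebra_simps add_mono)
  qed simp
  from R.subring_is_ring[OF this] show ?thesis
    by (simp add: intersection_algebra_powers_def intersection_algebra_def)
qed

lemma canonical_ideal_eq:
  "canonical_ideal a b = {f :: 'k::field poly poly poly. exponents f \<subseteq> interior_cone a b}"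
proof -
  have "monomial_of ` {\<beta> \<in> E_Phi a b. positive5 \<beta>}
      = {monom (monom (monom (1::'k) m) r) s | r s m. (r, s, m) \<in> interior_cone a b}"
  proof (intro equalityI subsetI)
    fix f :: "'k poly poly poly"
    assume "f \<in> {monom (monom (monom (1::'k) m) r) s | r s m. (r, s, m) \<in> interior_cone a b}"
    then obtain r s m where f: "f = monom (monom (monom (1::'k) m) r) s"
      and "(r, s, m) \<in> interior_cone a b" by blast
    then have "(r, s, m - a * r, m - b * s, m) \<in> {\<beta> \<in> E_Phi a b. positive5 \<beta>}"
      by (auto simp: E_Phi_def positive5_def interior_cone_def)
    from imageI[OF this, of "monomial_of :: nat5 \<Rightarrow> 'k poly poly poly"] f
    show "f \<in> monomial_of ` {\<beta> \<in> E_Phi a b. positive5 \<beta>}" by (simp add: monomial_of_def)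
  qed (force simp: monomial_of_def E_Phi_def positive5_def interior_cone_def)
  then show ?thesis unfolding canonical_ideal_def by (simp only: span_monomials)
qed

text \<open>The sum of an interior point of the cone and a point of the cone is an interior point.\<close>

lemma ideal_canonical_ideal:
  "ideal (canonical_ideal a b) (intersection_algebra_powers a b :: 'k::field poly poly poly ring)"
proof -
  let ?B = "intersection_algebra_powers a b :: 'k poly poly poly ring"
  interpret B: ring ?B by (rule ring_intersection_algebra_powers)
  have sub: "interior_cone a b \<subseteq> solution_cone a b" by (auto simp: solution_cone_def interior_cone_def)
  have minus: "\<ominus>\<^bsub>?B\<^esub> f = - f" if "f \<in> carrier ?B" for f
    by (rule B.minus_equality)
       (use that in \<open>auto simp: carrier_intersection_algebra_powers\<close>)
  have mult: "f * g \<in> canonical_ideal a b"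
    if "f \<in> canonical_ideal a b" "g \<in> carrier ?B" for f g
  proof -
    have "exponents (f * g) \<subseteq> interior_cone a b"
    proof (rule exponents_mult[of f "interior_cone a b" g "solution_cone a b"])
      show "exponents f \<subseteq> interior_cone a b" "exponents g \<subseteq> solution_cone a b"
        using that by (simp_all add: canonical_ideal_eq carrier_intersection_algebra_powers)
    qed (auto simp: interior_cone_def solution_cone_def algebra_simps add_less_le_mono add_le_less_mono)
    then show ?thesis by (simp add: canonical_ideal_eq)
  qed
  show ?thesis
  proof (rule idealI[OF B.ring_axioms])
    show "subgroup (canonical_ideal a b) (add_monoid ?B)"
    proof (rule B.add.subgroupI)
      show "canonical_ideal a b \<subseteq> carrier ?B"
        using sub by (auto simp: canonical_ideal_eq carrier_intersection_algebra_powers)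
      then show "\<ominus>\<^bsub>?B\<^esub> f \<in> canonical_ideal a b" if "f \<in> canonical_ideal a b" for f
        using that minus[OF subsetD, of "canonical_ideal a b" f] by (simp add: canonical_ideal_eq)
      show "canonical_ideal a b \<noteq> ({} :: 'k poly poly poly set)"
        by (auto simp: canonical_ideal_eq intro!: exI[of _ 0])
      show "f \<oplus>\<^bsub>?B\<^esub> g \<in> canonical_ideal a b"
        if "f \<in> canonical_ideal a b" "g \<in> canonical_ideal a b" for f g
        using that exponents_add[of f g] by (auto simp: canonical_ideal_eq)
    qed
  qed (use mult in \<open>auto simp: mult.commute\<close>)
qed

lemma minimal_monomials_subset_canonical_ideal:
  "monomial_of ` minimal_positive a b \<subseteq> (canonical_ideal a b :: 'k::field poly poly poly set)"
  unfolding canonical_ideal_def by (auto simp: minimal_positive_def intro!: scal.span_base)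

text \<open>For a minimal solution \<open>\<gamma> \<le> \<beta>\<close> the comparison of the slacks \<open>h\<close> and \<open>k\<close>, and not only of
  \<open>r\<close>, \<open>s\<close>, \<open>m\<close>, puts the quotient of the two monomials into the algebra.\<close>

lemma Idl_minimal_positive_eq_canonical_ideal:
  "Idl\<^bsub>intersection_algebra_powers a b\<^esub> (monomial_of ` minimal_positive a b)
     = (canonical_ideal a b :: 'k::field poly poly poly set)"
proof (rule antisym)
  let ?B = "intersection_algebra_powers a b :: 'k poly poly poly ring"
  let ?G = "monomial_of ` minimal_positive a b :: 'k poly poly poly set"
  interpret B: ring ?B by (rule ring_intersection_algebra_powers)
  show "Idl\<^bsub>?B\<^esub> ?G \<subseteq> canonical_ideal a b"
    by (rule B.genideal_minimal[OF ideal_canonical_ideal minimal_monomials_subset_canonical_ideal])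
  show "canonical_ideal a b \<subseteq> Idl\<^bsub>?B\<^esub> ?G"
    unfolding genideal_def
  proof (rule Inter_greatest)
    fix I assume "I \<in> {I. ideal I ?B \<and> ?G \<subseteq> I}"
    then have I: "ideal I ?B" and GI: "?G \<subseteq> I" by auto
    interpret I: ideal I ?B by (rule I)
    \<comment> \<open>The algebra contains the constants, so its ideals are closed under scalars.\<close>
    have "scal.subspace I"
      unfolding scal.subspace_def scalar_eq_mult
      using I.a_closed I.zero_closed I.I_l_closed[OF _ const_in_carrier] by simp
    moreover have "monomial_of ` {\<beta> \<in> E_Phi a b. positive5 \<beta>} \<subseteq> I"
    proof (rule image_subsetI)
      fix \<beta> assume \<beta>: "\<beta> \<in> {\<beta> \<in> E_Phi a b. positive5 \<beta>}"
      then obtain \<gamma> where \<gamma>: "\<gamma> \<in> minimal_positive a b" and le: "le5 \<gamma> \<beta>"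
        using ex_minimal_positive_le5 by blast
      obtain r s h k m where B: "\<beta> = (r, s, h, k, m)" by (cases \<beta>)
      obtain r' s' h' k' m' where C: "\<gamma> = (r', s', h', k', m')" by (cases \<gamma>)
      note e' = minimal_positiveD[OF \<gamma>[unfolded C]]
      have e: "a * r + h = m" "b * s + k = m" using \<beta> B by (auto simp: E_Phi_def)
      have l: "r' \<le> r" "s' \<le> s" "h' \<le> h" "k' \<le> k" "m' \<le> m" using le by (auto simp: B C le5_def)
      have "(r - r', s - s', m - m') \<in> solution_cone a b"
        using e e' l by (auto simp: solution_cone_def diff_mult_distrib2)
      then have "monom (monom (monom 1 (m - m')) (r - r')) (s - s') \<in> carrier ?B"
        by (auto simp: carrier_intersection_algebra_powers exponents_monom split: if_splits)
      from I.I_l_closed[OF _ this, of "monomial_of \<gamma>"]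
      have "monom (monom (monom 1 (m - m')) (r - r')) (s - s') * monomial_of \<gamma> \<in> I"
        using GI \<gamma> by auto
      then show "monomial_of \<beta> \<in> I" using l by (simp add: B C monomial_of_def mult_monom)
    qed
    ultimately show "canonical_ideal a b \<subseteq> I"
      unfolding canonical_ideal_def by (intro scal.span_minimal)
  qed
qed

theorem theorem2p24:
  fixes a b :: nat and q l :: int
  assumes "0 < b" and "b < a" and "coprime a b"
    and "int a = int b * q + l" and "1 \<le> l" and "l \<le> int b - 1"
  shows "(finite (minimal_positive a b) \<and> int (card (minimal_positive a b)) \<le> int a - l + 1) \<and>
    (\<exists>G :: 'k::field poly poly poly set.
       G \<subseteq> carrier (intersection_algebra_powers a b) \<and>
       finite G \<and> int (card G) \<le> int a - l + 1 \<and>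
       Idl\<^bsub>intersection_algebra_powers a b\<^esub> G = canonical_ideal a b)"
proof -
  have "0 < q"
  proof (rule ccontr)
    assume "\<not> 0 < q"
    then have "int b * q \<le> 0" by (simp add: mult_nonneg_nonpos)
    with assms show False by linarith
  qed
  define Q L where "Q = nat q" and "L = nat l"
  have QL: "q = int Q" "l = int L" using \<open>0 < q\<close> assms by (auto simp: Q_def L_def)
  have a: "a = b * Q + L" using assms(4) unfolding QL by (metis of_nat_add of_nat_eq_iff of_nat_mult)
  have L: "1 \<le> L" "L < b" and Q: "1 \<le> Q" using assms \<open>0 < q\<close> by (auto simp: QL)
  note card = card_minimal_positive_le[OF a L Q]
  have "0 \<le> (int b - 1) * (q - 1)" using assms \<open>0 < q\<close> by simp
  then have "int b + q \<le> int a - l + 1" using assms(4) by (simp add: algebra_simps)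
  then have bound: "int (card (minimal_positive a b)) \<le> int a - l + 1"
    using card(2) by (simp add: QL)
  let ?G = "monomial_of ` minimal_positive a b :: 'k poly poly poly set"
  have "?G \<subseteq> canonical_ideal a b" by (rule minimal_monomials_subset_canonical_ideal)
  also have "\<dots> \<subseteq> carrier (intersection_algebra_powers a b)"
    by (rule ideal.Icarr[OF ideal_canonical_ideal, THEN subsetI])
  finally have "?G \<subseteq> carrier (intersection_algebra_powers a b)" .
  moreover have "finite ?G" using card(1) by simp
  moreover have "int (card ?G) \<le> int a - l + 1"
    using card_image_le[OF card(1), of "monomial_of :: nat5 \<Rightarrow> 'k poly poly poly"] bound by linarith
  ultimately show ?thesis
    using card(1) bound Idl_minimal_positive_eq_canonical_ideal by blast
qed

end
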